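(* Let $(V,B)$ be a Steiner system of type $S(t,n,v)$, where $t<n\le v$, let $C=C_{(n,v)}\setminus B$, and let $X_C\subset\mathbb P^n$ be the Complement of the Steiner configuration of points with respect to a collection $\mathcal H=\{H_1,\dots,H_v\}$ of distinct hyperplanes of $\mathbb P^n$ any $n$ of which meet in a point. Then the $h$-vector of $X_C$ is $$h_{X_C}=\left(1,\ n,\ \binom{n+1}{n-1},\ \cdots,\ \binom{v-2}{n-1},\ \binom{v-1}{n-1}-|B|\right).$$
   Context: A Steiner system $(V,B)$ of type $S(t,n,v)$ consists of a set $V=\{1,\dots,v\}$ and a collection $B$ of $n$-subsets of $V$ (blocks) such that every $t$-subset of $V$ is contained in a unique block; then $|B|=\binom vt/\binom nt$. $C_{(n,v)}$ denotes the set of all $n$-subsets of $V$. Let $H_j$ be defined by the linear form $\ell_j$ over the field $k$. For an $n$-subset $\sigma$ of $V$ put $P_\sigma=\bigcap_{i\in\sigma}H_i$, a point with ideal $I_{P_\sigma}=(\ell_i:i\in\sigma)\subseteq R=k[x_0,\dots,x_n]$. Then $X_C=\{P_\sigma:\sigma\in C\}$ and $I_{X_C}=\bigcap_{\sigma\in C}I_{P_\sigma}$. For a finite set of points $X\subset\mathbb P^n$, $H_X(i)=\dim_k(R/I_X)_i$, $\Delta H_X(i)=H_X(i)-H_X(i-1)$, and the $h$-vector of $X$ is $(1,h_1,\dots,h_p)$ with $h_i=\Delta H_X(i)$ and $p$ the last index with $\Delta H_X(p)>0$. The last entry of $h_{X_C}$ is in degree $p=v-n$.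
   Formalization: It is also assumed that no n+1 of the hyperplanes share a point (four concurrent lines in the plane with S(1,2,4) violate the formula) and that n ≥ 2 (automatic for t ≥ 1; for n=1, t=0 the last entry would be 0). *)

theory Defs
  imports
    "HOL-Library.Poly_Mapping"
    "HOL-Analysis.Cartesian_Space"
    "HOL-Algebra.Embedded_Algebras"
    "HOL-Algebra.QuotRing"
begin

section \<open>Polynomials and projective space\<close>

text \<open>
  The polynomial ring over \<open>'k\<close> in variables indexed by the finite type \<open>'x\<close>. The ring
  \<open>k[x\<^sub>0, \<dots>, x\<^sub>n]\<close> and the space \<open>\<PP>\<^sup>n\<close> are the case \<open>CARD('x) = n + 1\<close>.
\<close>

type_synonym ('x, 'k) mpol = "('x \<Rightarrow>\<^sub>0 nat) \<Rightarrow>\<^sub>0 'k"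

definition mpol_ring :: "('x, 'k::comm_ring_1) mpol ring" where
  "mpol_ring = \<lparr>carrier = UNIV, mult = (*), one = 1, zero = 0, add = (+)\<rparr>"

abbreviation mpol_const :: "'k::field \<Rightarrow> ('x, 'k) mpol" where
  "mpol_const \<equiv> Poly_Mapping.single 0"

definition mpol_eval :: "('x::finite, 'k::field) mpol \<Rightarrow> 'k ^ 'x \<Rightarrow> 'k" where
  "mpol_eval F a = (\<Sum>m\<in>Poly_Mapping.keys F. Poly_Mapping.lookup F m * (\<Prod>i\<in>UNIV. (a $ i) ^ Poly_Mapping.lookup m i))"

definition form :: "nat \<Rightarrow> ('x::finite, 'k::field) mpol \<Rightarrow> bool" where
  "form d F \<longleftrightarrow> (\<forall>m\<in>Poly_Mapping.keys F. (\<Sum>i\<in>UNIV. Poly_Mapping.lookup m i) = d)"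

text \<open>A point of projective space is a line through the origin of \<open>'k ^ 'x\<close>.\<close>

definition proj_space :: "('k::field ^ 'x::finite) set set" where
  "proj_space = {range (\<lambda>c. c *s a) | a. a \<noteq> 0}"

definition proj_zeros :: "('x::finite, 'k::field) mpol \<Rightarrow> ('k ^ 'x) set set" where
  "proj_zeros F = {P \<in> proj_space. \<forall>a\<in>P. mpol_eval F a = 0}"

definition hyperplane :: "('k::field ^ 'x::finite) set set \<Rightarrow> bool" where
  "hyperplane H \<longleftrightarrow> (\<exists>l. form 1 l \<and> l \<noteq> 0 \<and> H = proj_zeros l)"


section \<open>Hilbert functions and h-vectors of sets of points\<close>

definition point_ideal :: "('k::field ^ 'x::finite) set \<Rightarrow> ('x, 'k) mpol set" where
  "point_ideal P = genideal mpol_ring {F. (\<exists>d. form d F) \<and> (\<forall>a\<in>P. mpol_eval F a = 0)}"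

definition points_ideal :: "('k::field ^ 'x::finite) set set \<Rightarrow> ('x, 'k) mpol set" where
  "points_ideal X = (\<Inter>P\<in>X. point_ideal P)"

text \<open>
  The dimension of the degree \<open>d\<close> part of \<open>R/I\<close>, which is the image of the forms of degree \<open>d\<close>,
  over the copy of the ground field in \<open>R/I\<close>, which is the image of the constants. If \<open>I = R\<close>,
  all these images are zero and the dimension is \<open>0\<close>.
\<close>

definition quotient_dim :: "('x::finite, 'k::field) mpol set \<Rightarrow> nat \<Rightarrow> nat" where
  "quotient_dim I d =
     ring.dim (mpol_ring Quot I)
       ((\<lambda>c. I +>\<^bsub>mpol_ring\<^esub> mpol_const c) ` UNIV)
       ((\<lambda>F. I +>\<^bsub>mpol_ring\<^esub> F) ` {F. form d F})"

definition hilbert_fun :: "('k::field ^ 'x::finite) set set \<Rightarrow> nat \<Rightarrow> nat" where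
  "hilbert_fun X d = quotient_dim (points_ideal X) d"

definition delta_hilbert :: "('k::field ^ 'x::finite) set set \<Rightarrow> nat \<Rightarrow> int" where
  "delta_hilbert X d =
     int (hilbert_fun X d) - (if d = 0 then 0 else int (hilbert_fun X (d - 1)))"

text \<open>
  On natural numbers \<open>Sup\<close> is the maximum, and \<open>Sup {} = 0\<close>. The set below is empty
  only for \<open>X = {}\<close>, whose h-vector is therefore \<open>[0]\<close>.
\<close>

definition h_vector :: "('k::field ^ 'x::finite) set set \<Rightarrow> int list" where
  "h_vector X = map (delta_hilbert X) [0..<Suc (Sup {d. delta_hilbert X d > 0})]"


section \<open>Steiner systems and configurations of points\<close>

definition steiner_system :: "nat \<Rightarrow> nat \<Rightarrow> nat \<Rightarrow> nat set set \<Rightarrow> bool" where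
  "steiner_system t n v B \<longleftrightarrow>
     (\<forall>b\<in>B. b \<subseteq> {1..v} \<and> card b = n) \<and>
     (\<forall>T. T \<subseteq> {1..v} \<and> card T = t \<longrightarrow> (\<exists>!b. b \<in> B \<and> T \<subseteq> b))"

definition subsets_of_card :: "nat \<Rightarrow> nat \<Rightarrow> nat set set" where
  "subsets_of_card n v = {\<sigma>. \<sigma> \<subseteq> {1..v} \<and> card \<sigma> = n}"

text \<open>
  The hyperplanes of a star configuration meet properly: any \<open>n\<close> of them meet in exactly one
  point and no \<open>n + 1\<close> of them have a common point. The second part says that distinct
  \<open>n\<close>-subsets give distinct points; it does not follow from the first one (take concurrent lines
  in the plane).
\<close>

definition meet_properly ::
    "nat \<Rightarrow> nat \<Rightarrow> (nat \<Rightarrow> ('k::field ^ 'x::finite) set set) \<Rightarrow> bool" where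
  "meet_properly n v H \<longleftrightarrow>
     (\<forall>\<sigma>\<in>subsets_of_card n v. \<exists>P. (\<Inter>i\<in>\<sigma>. H i) = {P}) \<and>
     (\<forall>\<tau>\<in>subsets_of_card (n + 1) v. (\<Inter>i\<in>\<tau>. H i) = {})"

definition config_point ::
    "(nat \<Rightarrow> ('k::field ^ 'x::finite) set set) \<Rightarrow> nat set \<Rightarrow> ('k ^ 'x) set" where
  "config_point H \<sigma> = the_elem (\<Inter>i\<in>\<sigma>. H i)"

definition config_points ::
    "(nat \<Rightarrow> ('k::field ^ 'x::finite) set set) \<Rightarrow> nat set set \<Rightarrow> ('k ^ 'x) set set" where
  "config_points H C = config_point H ` C"


section \<open>The ideal of an intersection point\<close>

interpretation mpol: cring "mpol_ring :: ('x, 'k::comm_ring_1) mpol ring"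
  rewrites "carrier mpol_ring = UNIV"
    and "x \<otimes>\<^bsub>mpol_ring\<^esub> y = x * y" and "x \<oplus>\<^bsub>mpol_ring\<^esub> y = x + y"
    and "\<one>\<^bsub>mpol_ring\<^esub> = 1" and "\<zero>\<^bsub>mpol_ring\<^esub> = 0"
proof -
  show "cring (mpol_ring :: ('x, 'k) mpol ring)"
    by (rule cringI; (rule abelian_groupI | rule comm_monoidI)?)
      (auto simp: mpol_ring_def algebra_simps intro: exI[of _ "- _"] left_minus)
qed (auto simp: mpol_ring_def)

definition lin_form :: "'k ^ 'x \<Rightarrow> ('x::finite, 'k::field) mpol" where
  "lin_form w = (\<Sum>j\<in>UNIV. Poly_Mapping.single (Poly_Mapping.single j 1) (w $ j))"

lemma single_variable_inj: "Poly_Mapping.single x (Suc 0) = Poly_Mapping.single j (Suc 0) \<Longrightarrow> x = j"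
  by (metis lookup_single_eq lookup_single_not_eq nat.distinct(1))

lemma lookup_lin_form: "Poly_Mapping.lookup (lin_form w) (Poly_Mapping.single j 1) = w $ j"
proof -
  have "Poly_Mapping.lookup (lin_form w) (Poly_Mapping.single j 1) = (\<Sum>i\<in>UNIV. if i = j then w $ i else 0)"
    unfolding lin_form_def lookup_sum by (rule sum.cong) (auto simp: lookup_single when_def dest!: single_variable_inj)
  thus ?thesis by simp
qed

lemma monomial_degree_1: 
  assumes "(\<Sum>i\<in>UNIV. Poly_Mapping.lookup m (i::'x::finite)) = Suc 0"
  shows "\<exists>j. m = Poly_Mapping.single j 1"
proof -
  obtain j where j: "Poly_Mapping.lookup m j = Suc 0" "\<And>i. i \<noteq> j \<Longrightarrow> Poly_Mapping.lookup m i = 0"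
    using assms by (auto simp: sum_eq_Suc0_iff)
  have "m = Poly_Mapping.single j 1"
    by (rule poly_mapping_eqI) (use j in \<open>auto simp: lookup_single when_def\<close>)
  thus ?thesis by blast
qed

lemma form_1_eq_lin_form: 
  assumes "form 1 (l :: ('x::finite, 'k::field) mpol)" 
  shows "l = lin_form (\<chi> j. Poly_Mapping.lookup l (Poly_Mapping.single j 1))" (is "l = ?r")
proof (rule poly_mapping_eqI)
  fix m
  show "Poly_Mapping.lookup l m = Poly_Mapping.lookup ?r m"
  proof (cases "\<exists>j. m = Poly_Mapping.single j 1")
    case True thus ?thesis by (auto simp: lookup_lin_form simp del: One_nat_def)
  next
    case False
    hence "m \<notin> Poly_Mapping.keys l" using monomial_degree_1[of m] assms unfolding form_def by force
    moreover have "Poly_Mapping.lookup ?r m = 0"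
      unfolding lin_form_def lookup_sum using False by (intro sum.neutral) (auto simp: lookup_single when_def)
    ultimately show ?thesis by (simp add: in_keys_iff)
  qed
qed

lemma mpol_eval_superset:
  assumes "finite K" "Poly_Mapping.keys F \<subseteq> K"
  shows "mpol_eval F a = (\<Sum>m\<in>K. Poly_Mapping.lookup F m * (\<Prod>i\<in>UNIV. (a $ i) ^ Poly_Mapping.lookup m i))"
  unfolding mpol_eval_def by (rule sum.mono_neutral_left) (use assms in \<open>auto simp: in_keys_iff\<close>)

lemma mpol_eval_add: "mpol_eval (F + G) a = mpol_eval F a + mpol_eval G a"
proof -
  let ?K = "Poly_Mapping.keys F \<union> Poly_Mapping.keys G"
  have K: "finite ?K" "Poly_Mapping.keys F \<subseteq> ?K" "Poly_Mapping.keys G \<subseteq> ?K" "Poly_Mapping.keys (F+G) \<subseteq> ?K"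
    using Poly_Mapping.keys_add[of F G] by auto
  show ?thesis unfolding mpol_eval_superset[OF K(1,2)] mpol_eval_superset[OF K(1,3)] mpol_eval_superset[OF K(1,4)]
    by (simp add: lookup_add algebra_simps sum.distrib)
qed

lemma mpol_eval_0: "mpol_eval 0 a = 0" by (simp add: mpol_eval_def)

lemma mpol_eval_sum: "mpol_eval (\<Sum>i\<in>A. f i) a = (\<Sum>i\<in>A. mpol_eval (f i) a)"
  by (induction A rule: infinite_finite_induct) (auto simp: mpol_eval_add mpol_eval_0)

lemma mpol_eval_single: "mpol_eval (Poly_Mapping.single m c) a = c * (\<Prod>i\<in>UNIV. (a $ i) ^ Poly_Mapping.lookup m i)"
  by (cases "c = 0") (auto simp: mpol_eval_def)

lemma mpol_eval_lin_form: "mpol_eval (lin_form w) a = (\<Sum>j\<in>UNIV. w $ j * a $ j)"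
proof -
  have "(\<Prod>i\<in>UNIV. (a $ i) ^ Poly_Mapping.lookup (Poly_Mapping.single j (1::nat)) i) = a $ j" for j
  proof -
    have "(\<Prod>i\<in>UNIV. (a $ i) ^ Poly_Mapping.lookup (Poly_Mapping.single j (1::nat)) i) = (\<Prod>i\<in>UNIV. if i = j then a $ i else 1)"
      by (rule prod.cong) (auto simp: lookup_single when_def)
    thus ?thesis by simp
  qed
  thus ?thesis by (simp add: lin_form_def mpol_eval_sum mpol_eval_single del: One_nat_def)
qed

lemma lin_form_add: "lin_form (u + w) = lin_form u + lin_form w"
  by (simp add: lin_form_def single_add sum.distrib)

lemma lin_form_scale: "lin_form (c *s w) = mpol_const c * lin_form w"
  by (simp add: lin_form_def sum_distrib_left mult_single)

lemma lin_form_0: "lin_form 0 = 0" by (simp add: lin_form_def)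

lemma separating_functional:
  fixes w :: "'k::field ^ 'x::finite"
  assumes "w \<notin> vec.span S"
  shows "\<exists>b. (\<forall>s\<in>S. (\<Sum>j\<in>UNIV. s $ j * b $ j) = 0) \<and> (\<Sum>j\<in>UNIV. w $ j * b $ j) \<noteq> 0"
proof -
  interpret vector_space_pair "(*s) :: 'k \<Rightarrow> 'k ^ 'x \<Rightarrow> 'k ^ 'x" "(*) :: 'k \<Rightarrow> 'k \<Rightarrow> 'k"
    by unfold_locales (auto simp: algebra_simps)
  obtain A where A: "A \<subseteq> S" "vec.independent A" "S \<subseteq> vec.span A"
    by (rule vec.maximal_independent_subset)
  have "vec.span A = vec.span S" using A by (metis vec.span_mono vec.span_minimal vec.subspace_span subset_antisym)
  with assms have wA: "w \<notin> vec.span A" by simp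
  hence ind: "vec.independent (insert w A)" using A(2) by (simp add: vec.independent_insert)
  obtain g where g: "Vector_Spaces.linear (*s) (*) g" "\<forall>x\<in>insert w A. g x = (if x = w then 1 else 0)"
    using linear_independent_extend[OF ind, of "\<lambda>x. if x = w then 1 else 0"] by blast
  interpret g: Vector_Spaces.linear "(*s) :: 'k \<Rightarrow> 'k ^ 'x \<Rightarrow> 'k ^ 'x" "(*) :: 'k \<Rightarrow> 'k \<Rightarrow> 'k" g by fact
  have gA: "g x = 0" if "x \<in> vec.span A" for x
    using that by (rule g.eq_0_on_span[rotated]) (use g(2) wA vec.span_base in fastforce)
  define b where "b = (\<chi> j. g (axis j 1))"
  have gb: "g u = (\<Sum>j\<in>UNIV. u $ j * b $ j)" for u
  proof -
    have "u = (\<Sum>j\<in>UNIV. u $ j *s axis j 1)" by (simp add: basis_expansion)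
    hence "g u = g (\<Sum>j\<in>UNIV. u $ j *s axis j 1)" by simp
    thus ?thesis by (simp add: g.sum g.scale b_def)
  qed
  show ?thesis
    by (rule exI[of _ b]) (use gA A(3) g(2) in \<open>auto simp flip: gb\<close>)
qed

lemma monomial_eq_prod:
  "Poly_Mapping.single m (1::'k::field) = (\<Prod>j\<in>UNIV. Poly_Mapping.single (Poly_Mapping.single (j::'x::finite) (1::nat)) 1 ^ Poly_Mapping.lookup m j)"
proof -
  have pw: "Poly_Mapping.single k (1::'k) ^ e = Poly_Mapping.single (\<Sum>_<e. k) 1" for k :: "'x \<Rightarrow>\<^sub>0 nat" and e :: nat
    by (induction e) (auto simp: mult_single add.commute)
  have pr: "(\<Prod>j\<in>A. Poly_Mapping.single (f j) (1::'k)) = Poly_Mapping.single (\<Sum>j\<in>A. f j) 1" 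
    for f :: "'x \<Rightarrow> 'x \<Rightarrow>\<^sub>0 nat" and A
    by (induction A rule: infinite_finite_induct) (auto simp: mult_single)
  have m: "(\<Sum>j\<in>UNIV. \<Sum>_<Poly_Mapping.lookup m j. Poly_Mapping.single j (1::nat)) = m"
  proof (rule poly_mapping_eqI)
    fix i
    have "Poly_Mapping.lookup (\<Sum>j\<in>UNIV. \<Sum>_<Poly_Mapping.lookup m j. Poly_Mapping.single j (1::nat)) i
      = (\<Sum>j\<in>UNIV. if j = i then Poly_Mapping.lookup m j else 0)"
      unfolding lookup_sum by (rule sum.cong) (auto simp: lookup_single when_def)
    thus "Poly_Mapping.lookup (\<Sum>j\<in>UNIV. \<Sum>_<Poly_Mapping.lookup m j. Poly_Mapping.single j (1::nat)) i = Poly_Mapping.lookup m i"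
      by simp
  qed
  show ?thesis unfolding pw pr m ..
qed

lemma mpol_const_mult: "mpol_const (x * y) = mpol_const x * mpol_const (y::'k::field)" for x by (simp add: mult_single)
lemma mpol_const_power: "mpol_const (x ^ e) = mpol_const (x::'k::field) ^ e" by (induction e) (simp_all add: mpol_const_mult)
lemma mpol_const_prod: "mpol_const (\<Prod>j\<in>A. f j) = (\<Prod>j\<in>A. mpol_const (f j :: 'k::field))"
  by (induction A rule: infinite_finite_induct) (auto simp: mpol_const_mult)
lemma mpol_const_sum: "mpol_const (\<Sum>j\<in>A. f j) = (\<Sum>j\<in>A. mpol_const (f j :: 'k::field))"
  by (induction A rule: infinite_finite_induct) (auto simp: single_add)

lemma mpol_eq_sum_monomials: "F = (\<Sum>m\<in>Poly_Mapping.keys F. Poly_Mapping.single m (Poly_Mapping.lookup F m))"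
proof (rule poly_mapping_eqI)
  fix k
  have "Poly_Mapping.lookup (\<Sum>m\<in>Poly_Mapping.keys F. Poly_Mapping.single m (Poly_Mapping.lookup F m)) k
    = (\<Sum>m\<in>Poly_Mapping.keys F. if m = k then Poly_Mapping.lookup F m else 0)"
    unfolding lookup_sum by (rule sum.cong) (auto simp: lookup_single when_def)
  thus "Poly_Mapping.lookup F k = Poly_Mapping.lookup (\<Sum>m\<in>Poly_Mapping.keys F. Poly_Mapping.single m (Poly_Mapping.lookup F m)) k"
    by (simp add: in_keys_iff)
qed

lemma vanishing_form_in_ideal:
  fixes F :: "('x::finite, 'k::field) mpol"
  assumes I0: "0 \<in> I" and Ia: "\<And>x y. x \<in> I \<Longrightarrow> y \<in> I \<Longrightarrow> x + y \<in> I" and Im: "\<And>x y. x \<in> I \<Longrightarrow> y * x \<in> I"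
    and X: "\<And>w. (\<Sum>j\<in>UNIV. w $ j * a $ j) = 0 \<Longrightarrow> lin_form w \<in> I"
    and a: "a \<noteq> 0" and F: "form d F" "mpol_eval F a = 0"
  shows "F \<in> I"
proof -
  obtain j0 where j0: "a $ j0 \<noteq> 0" using a by (auto simp: vec_eq_iff)
  define V :: "'x \<Rightarrow> ('x, 'k) mpol" where "V j = Poly_Mapping.single (Poly_Mapping.single j 1) 1" for j
  have V: "V j = lin_form (axis j 1)" for j
  proof -
    have "lin_form (axis j 1) = (\<Sum>i\<in>UNIV. if i = j then V i else 0)"
      unfolding lin_form_def by (rule sum.cong) (auto simp: V_def axis_def)
    thus ?thesis by simp
  qed
  define M where "M = mpol_const (inverse (a $ j0)) * V j0"
  have VM: "V j - mpol_const (a $ j) * M \<in> I" for j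
  proof -
    let ?w = "axis j 1 + (- (a $ j * inverse (a $ j0))) *s axis j0 1"
    have ax: "(\<Sum>i\<in>UNIV. axis j (1::'k) $ i * a $ i) = a $ j" for j
    proof -
      have "(\<Sum>i\<in>UNIV. axis j (1::'k) $ i * a $ i) = (\<Sum>i\<in>UNIV. if i = j then a $ i else 0)"
        by (rule sum.cong) (auto simp: axis_def)
      thus ?thesis by simp
    qed
    have "(\<Sum>i\<in>UNIV. ?w $ i * a $ i) = a $ j + (- (a $ j * inverse (a $ j0))) * a $ j0"
      by (simp only: vector_add_component vector_smult_component distrib_right sum.distrib mult.assoc
            sum_distrib_left[symmetric] ax)
    also have "\<dots> = 0" using j0 by simp
    finally have "lin_form ?w \<in> I" by (rule X)
    moreover have "lin_form ?w = V j - mpol_const (a $ j) * M"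
      unfolding lin_form_add lin_form_scale V[symmetric] M_def single_uminus mpol_const_mult by (simp add: algebra_simps)
    ultimately show ?thesis by simp
  qed
  have mul: "x * y - x' * y' \<in> I" if "x - x' \<in> I" "y - y' \<in> I" for x y x' y'
  proof -
    have "x * y - x' * y' = x * (y - y') + y' * (x - x')" by (simp add: algebra_simps)
    thus ?thesis using that Ia Im by metis
  qed
  have pw: "x ^ e - x' ^ e \<in> I" if "x - x' \<in> I" for x x' and e :: nat
    by (induction e) (use I0 that mul in auto)
  have pr: "(\<Prod>j\<in>A. f j) - (\<Prod>j\<in>A. g j) \<in> I" if "\<And>j. f j - g j \<in> I" for f g and A :: "'x set"
    by (induction A rule: infinite_finite_induct) (use I0 that mul in auto)
  have sm: "(\<Sum>j\<in>A. f j) \<in> I" if "\<And>j. j \<in> A \<Longrightarrow> f j \<in> I" for f and A :: "('x \<Rightarrow>\<^sub>0 nat) set"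
    using that by (induction A rule: infinite_finite_induct) (use I0 Ia in auto)
  let ?c = "Poly_Mapping.lookup F" let ?K = "Poly_Mapping.keys F"
  let ?e = "\<lambda>m. \<Prod>i\<in>UNIV. (a $ i) ^ Poly_Mapping.lookup m i"
  have key: "Poly_Mapping.single m (?c m) - mpol_const (?c m * ?e m) * M ^ d \<in> I" if "m \<in> ?K" for m
  proof -
    have d: "(\<Sum>i\<in>UNIV. Poly_Mapping.lookup m i) = d" using that F(1) by (simp add: form_def)
    have "(\<Prod>j\<in>UNIV. V j ^ Poly_Mapping.lookup m j) - (\<Prod>j\<in>UNIV. (mpol_const (a $ j) * M) ^ Poly_Mapping.lookup m j) \<in> I"
      by (intro pr pw VM)
    moreover have "(\<Prod>j\<in>UNIV. (mpol_const (a $ j) * M) ^ Poly_Mapping.lookup m j) = mpol_const (?e m) * M ^ d"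
      by (simp add: power_mult_distrib prod.distrib mpol_const_prod mpol_const_power flip: power_sum d)
    ultimately have "Poly_Mapping.single m 1 - mpol_const (?e m) * M ^ d \<in> I"
      unfolding V_def monomial_eq_prod[symmetric] by simp
    hence "mpol_const (?c m) * (Poly_Mapping.single m 1 - mpol_const (?e m) * M ^ d) \<in> I" by (rule Im)
    moreover have "Poly_Mapping.single m (?c m) = mpol_const (?c m) * Poly_Mapping.single m 1" by (simp add: mult_single)
    ultimately show ?thesis by (simp only: mpol_const_mult right_diff_distrib mult.assoc)
  qed
  have "(\<Sum>m\<in>?K. Poly_Mapping.single m (?c m) - mpol_const (?c m * ?e m) * M ^ d) \<in> I" by (rule sm, rule key)
  also have "(\<Sum>m\<in>?K. Poly_Mapping.single m (?c m) - mpol_const (?c m * ?e m) * M ^ d) = F - mpol_const (mpol_eval F a) * M ^ d"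
    by (subst (3) mpol_eq_sum_monomials) (simp only: sum_subtractf mpol_eval_def mpol_const_sum sum_distrib_right)
  finally show ?thesis by (simp add: F(2))
qed

text \<open>
  If linear forms meet in a single point, then they generate the ideal of that point.
\<close>

lemma point_ideal_eq_genideal:
  fixes l :: "nat \<Rightarrow> ('x::finite, 'k::field) mpol"
  assumes l: "\<And>i. i \<in> \<sigma> \<Longrightarrow> form 1 (l i)" and P: "(\<Inter>i\<in>\<sigma>. proj_zeros (l i)) = {P}" and ne: "\<sigma> \<noteq> {}"
  shows "point_ideal P = genideal mpol_ring (l ` \<sigma>)"
proof -
  define I where "I = genideal mpol_ring (l ` \<sigma>)"
  have id: "ideal I mpol_ring" unfolding I_def by (rule mpol.genideal_ideal) simp
  interpret I: ideal I "mpol_ring :: ('x, 'k) mpol ring" by fact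
  have I0: "0 \<in> I" using I.zero_closed by (simp add: mpol_ring_def)
  have Ia: "x + y \<in> I" if "x \<in> I" "y \<in> I" for x y using I.a_closed[OF that] by (simp add: mpol_ring_def)
  have Im: "y * x \<in> I" if "x \<in> I" for x y using I.I_l_closed[OF that, of y] by (simp add: mpol_ring_def)
  have PP: "P \<in> proj_zeros (l i)" if "i \<in> \<sigma>" for i using P that by blast
  then have "P \<in> proj_space" using ne by (auto simp: proj_zeros_def)
  then obtain a where a: "a \<noteq> 0" "P = range (\<lambda>c. c *s a)" by (auto simp: proj_space_def)
  have aP: "a \<in> P" unfolding a(2) by (rule range_eqI[of _ _ 1]) simp
  define w where "w i = (\<chi> j. Poly_Mapping.lookup (l i) (Poly_Mapping.single j 1))" for i
  have w: "l i = lin_form (w i)" if "i \<in> \<sigma>" for i using form_1_eq_lin_form[OF l[OF that]] by (simp add: w_def)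
  have lI: "l i \<in> I" if "i \<in> \<sigma>" for i
    using that mpol.genideal_self[of "l ` \<sigma>"] unfolding I_def by auto
  have X: "lin_form u \<in> I" if u: "(\<Sum>j\<in>UNIV. u $ j * a $ j) = 0" for u
  proof -
    have "u \<in> vec.span (w ` \<sigma>)"
    proof (rule ccontr)
      assume "u \<notin> vec.span (w ` \<sigma>)"
      then obtain b where b: "\<forall>i\<in>\<sigma>. (\<Sum>j\<in>UNIV. w i $ j * b $ j) = 0" "(\<Sum>j\<in>UNIV. u $ j * b $ j) \<noteq> 0"
        using separating_functional by blast
      have "b \<noteq> 0" using b(2) by auto
      have "range (\<lambda>c. c *s b) \<in> (\<Inter>i\<in>\<sigma>. proj_zeros (l i))"
      proof (rule INT_I)
        fix i assume i: "i \<in> \<sigma>"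
        have "(\<Sum>j\<in>UNIV. w i $ j * (c * b $ j)) = c * (\<Sum>j\<in>UNIV. w i $ j * b $ j)" for c
          by (simp add: sum_distrib_left algebra_simps)
        then show "range (\<lambda>c. c *s b) \<in> proj_zeros (l i)"
          using b(1) i \<open>b \<noteq> 0\<close> by (auto simp: proj_zeros_def proj_space_def w mpol_eval_lin_form)
      qed
      hence "range (\<lambda>c. c *s b) = P" unfolding P by simp
      moreover have "b \<in> range (\<lambda>c. c *s b)" by (rule range_eqI[of _ _ 1]) simp
      ultimately obtain c where "b = c *s a" using a(2) by auto
      hence "(\<Sum>j\<in>UNIV. u $ j * b $ j) = c * (\<Sum>j\<in>UNIV. u $ j * a $ j)"
        by (simp add: sum_distrib_left algebra_simps)
      with u b(2) show False by simp
    qed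
    thus ?thesis
    proof (induction rule: vec.span_induct_alt)
      case base thus ?case by (simp add: lin_form_0 I0)
    next
      case (step c x y) thus ?case using w lI by (auto simp: lin_form_add lin_form_scale intro!: Ia Im)
    qed
  qed
  have "F \<in> I" if "form d F" "\<forall>a\<in>P. mpol_eval F a = 0" for F d
    by (rule vanishing_form_in_ideal[OF I0 Ia Im X a(1) that(1)]) (use that(2) aP in auto)
  hence "point_ideal P \<subseteq> I"
    unfolding point_ideal_def by (intro mpol.genideal_minimal id) auto
  moreover have "I \<subseteq> point_ideal P"
    unfolding I_def point_ideal_def
  proof (rule mpol.genideal_minimal[OF mpol.genideal_ideal])
    show "l ` \<sigma> \<subseteq> genideal mpol_ring {F. (\<exists>d. form d F) \<and> (\<forall>a\<in>P. mpol_eval F a = 0)}"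
      using PP l by (intro order.trans[OF _ mpol.genideal_self]) (auto simp: proj_zeros_def)
  qed simp
  ultimately show ?thesis unfolding I_def by blast
qed

end

theory Submission
  imports Defs "HOL-Library.Multiset"
begin

text \<open>
  Let \<open>p\<^sub>\<sigma>\<close> represent the point \<open>P\<^sub>\<sigma>\<close>, and for \<open>m \<le> v\<close> and an \<open>n\<close>-subset \<open>\<sigma>\<close> of \<open>{1..m}\<close> let \<open>M\<^sub>\<sigma>\<close> be the
  product of the \<open>l\<^sub>i\<close> with \<open>i \<in> {1..m} - \<sigma>\<close>. These forms of degree \<open>d = m - n\<close> satisfy
  \<open>M\<^sub>\<sigma>(p\<^sub>\<tau>) \<noteq> 0\<close> iff \<open>\<sigma> = \<tau>\<close>, and there are as many of them as monomials of degree \<open>d\<close>, so they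
  are a basis of the forms of degree \<open>d\<close>.

  Suppose that a form \<open>F\<close> of degree \<open>d < v - n\<close> vanishes on the complement of the Steiner
  configuration. Then only blocks occur in its expansion \<open>\<Sum> c\<^sub>\<sigma> M\<^sub>\<sigma>\<close> for \<open>m = n + d < v\<close>. For such
  a block \<open>\<sigma>\<close> choose \<open>T \<subseteq> \<sigma>\<close> with \<open>n - 1\<close> elements. No other block contains \<open>T\<close>, so \<open>F\<close> vanishes
  at the point of \<open>T \<union> {m + 1}\<close>, where \<open>M\<^sub>\<sigma>\<close> is the only nonzero term; hence \<open>c\<^sub>\<sigma> = 0\<close>.
  So the Hilbert function of \<open>X\<^sub>C\<close> is that of the polynomial ring in degrees below \<open>v - n\<close>. From degree
  \<open>v - n\<close> on it is \<open>|C|\<close>, because there the \<open>M\<^sub>\<sigma>\<close> for \<open>m = v\<close>, times powers of linear forms,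
  separate the points.
\<close>

section \<open>Forms and evaluation\<close>

lemma mpol_ring_simps:
  "carrier mpol_ring = UNIV" "x \<otimes>\<^bsub>mpol_ring\<^esub> y = x * y" "x \<oplus>\<^bsub>mpol_ring\<^esub> y = x + y"
  "\<one>\<^bsub>mpol_ring\<^esub> = 1" "\<zero>\<^bsub>mpol_ring\<^esub> = 0"
  by (simp_all add: mpol_ring_def)

lemma mpol_uminus: "\<ominus>\<^bsub>mpol_ring\<^esub> F = - (F :: ('x, 'k::comm_ring_1) mpol)"
  by (rule mpol.minus_equality) auto

lemma mpol_eval_mult: "mpol_eval (F * G) a = mpol_eval F a * mpol_eval G a"
proof -
  let ?s = "\<lambda>F m. Poly_Mapping.single m (Poly_Mapping.lookup F m)"
  have "mpol_eval (Poly_Mapping.single m c * Poly_Mapping.single m' c') a =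
      mpol_eval (Poly_Mapping.single m c) a * mpol_eval (Poly_Mapping.single m' c') a" for m m' c c'
    by (simp add: mult_single mpol_eval_single lookup_add power_add prod.distrib mult_ac)
  then have "mpol_eval (sum (?s F) (Poly_Mapping.keys F) * sum (?s G) (Poly_Mapping.keys G)) a =
      mpol_eval (sum (?s F) (Poly_Mapping.keys F)) a * mpol_eval (sum (?s G) (Poly_Mapping.keys G)) a"
    by (simp add: sum_product mpol_eval_sum)
  then show ?thesis
    by (simp flip: mpol_eq_sum_monomials)
qed

lemma mpol_eval_const: "mpol_eval (mpol_const c) a = c"
  by (simp add: mpol_eval_single)

lemma mpol_eval_diff: "mpol_eval (F - G) a = mpol_eval F a - mpol_eval G a"
  by (metis diff_add_cancel eq_diff_eq mpol_eval_add)

lemma mpol_eval_prod: "mpol_eval (\<Prod>i\<in>A. f i) a = (\<Prod>i\<in>A. mpol_eval (f i) a)"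
  using mpol_eval_const[of 1 a]
  by (induction A rule: infinite_finite_induct) (auto simp: mpol_eval_mult)

lemma mpol_eval_scale:
  assumes "form d F"
  shows "mpol_eval F (c *s a) = c ^ d * mpol_eval F a"
  unfolding mpol_eval_def sum_distrib_left
proof (rule sum.cong)
  fix m assume "m \<in> Poly_Mapping.keys F"
  then have "d = (\<Sum>i\<in>UNIV. Poly_Mapping.lookup m i)"
    using assms by (simp add: form_def)
  then show "Poly_Mapping.lookup F m * (\<Prod>i\<in>UNIV. ((c *s a) $ i) ^ Poly_Mapping.lookup m i) =
      c ^ d * (Poly_Mapping.lookup F m * (\<Prod>i\<in>UNIV. (a $ i) ^ Poly_Mapping.lookup m i))"
    by (simp add: power_mult_distrib prod.distrib power_sum)
qed simp

lemma form_vanishes_on_line_iff: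
  assumes "form d F"
  shows "(\<forall>c. mpol_eval F (c *s a) = 0) \<longleftrightarrow> mpol_eval F a = 0"
  using mpol_eval_scale[OF assms, of _ a] by (metis mult_zero_right vec.scale_one)

lemma form_0: "form d 0"
  by (simp add: form_def)

lemma form_add: "form d F \<Longrightarrow> form d G \<Longrightarrow> form d (F + G)"
  unfolding form_def using Poly_Mapping.keys_add[of F G] by blast

lemma form_diff: "form d F \<Longrightarrow> form d G \<Longrightarrow> form d (F - G)"
  unfolding form_def using keys_diff[of F G] by blast

lemma form_sum: "(\<And>i. i \<in> A \<Longrightarrow> form d (f i)) \<Longrightarrow> form d (\<Sum>i\<in>A. f i)"
  by (induction A rule: infinite_finite_induct) (auto simp: form_0 form_add)

lemma form_mult:
  assumes "form d F" "form e G"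
  shows "form (d + e) (F * G)"
  unfolding form_def
proof
  fix m assume "m \<in> Poly_Mapping.keys (F * G)"
  then obtain k l where "m = k + l" "k \<in> Poly_Mapping.keys F" "l \<in> Poly_Mapping.keys G"
    using keys_mult[of F G] by blast
  then show "(\<Sum>i\<in>UNIV. Poly_Mapping.lookup m i) = d + e"
    using assms by (simp add: form_def lookup_add sum.distrib)
qed

lemma form_const: "form 0 (mpol_const c)"
  by (simp add: form_def)

lemma form_const_mult: "form d F \<Longrightarrow> form d (mpol_const c * F)"
  using form_mult[OF form_const] by fastforce

lemma form_prod:
  assumes "\<And>i. i \<in> A \<Longrightarrow> form 1 (f i)"
  shows "form (card A) (\<Prod>i\<in>A. f i)"
  using assms
proof (induction A rule: infinite_finite_induct)
  case (insert i A)
  then show ?case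
    using form_mult[of 1 "f i" "card A"] by simp
qed (use form_const[of 1] in auto)

section \<open>Counting monomials and interpolating forms\<close>

text \<open>Exponent vectors are multiplicity functions, so monomials of degree \<open>d\<close>
  inject into the multisets of size \<open>d\<close> on the variables.\<close>

lemma card_monomials_le:
  fixes d :: nat
  defines "M \<equiv> {m :: 'x::finite \<Rightarrow>\<^sub>0 nat. (\<Sum>i\<in>UNIV. Poly_Mapping.lookup m i) = d}"
  shows "finite M" "card M \<le> (CARD('x) + d - 1) choose d"
proof -
  define f where "f m = Abs_multiset (Poly_Mapping.lookup m)" for m :: "'x \<Rightarrow>\<^sub>0 nat"
  have count_f: "count (f m) = Poly_Mapping.lookup m" for m
    unfolding f_def by (rule count_Abs_multiset) simp
  have "inj_on f M"
    by (rule inj_onI, rule poly_mapping_eqI) (metis count_f)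
  moreover have "f ` M \<subseteq> multisets_of_size UNIV d"
  proof (clarsimp simp: M_def multisets_of_size_def)
    fix m :: "'x \<Rightarrow>\<^sub>0 nat"
    have "size (f m) = (\<Sum>i\<in>UNIV. count (f m) i)"
      unfolding size_multiset_overloaded_eq
      by (rule sum.mono_neutral_left) (auto simp: not_in_iff)
    then show "size (f m) = (\<Sum>i\<in>UNIV. Poly_Mapping.lookup m i)"
      by (simp add: count_f)
  qed
  ultimately show "finite M" "card M \<le> (CARD('x) + d - 1) choose d"
    using inj_on_finite card_inj_on_le[of f M "multisets_of_size UNIV d"]
      finite_multisets_of_size[of "UNIV :: 'x set" d] card_multisets_of_size[of "UNIV :: 'x set" d]
    by force+
qed

lemma mpol_eval_sum_diagonal:
  assumes "finite S" "t \<in> S" "\<And>s. s \<in> S \<Longrightarrow> s \<noteq> t \<Longrightarrow> mpol_eval (G s) a = 0"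
  shows "mpol_eval (\<Sum>s\<in>S. mpol_const (c s) * G s) a = c t * mpol_eval (G t) a"
proof -
  have "mpol_eval (\<Sum>s\<in>S. mpol_const (c s) * G s) a =
      (\<Sum>s\<in>S. if s = t then c t * mpol_eval (G t) a else 0)"
    unfolding mpol_eval_sum mpol_eval_mult mpol_eval_const
    by (rule sum.cong) (use assms in auto)
  then show ?thesis
    using assms by simp
qed

lemma vector_space_mpol: "vector_space (\<lambda>c F. mpol_const c * (F :: ('x, 'k::field) mpol))"
  by unfold_locales (auto simp: algebra_simps single_add mpol_const_mult)

text \<open>Evaluation at the \<open>p t\<close> is diagonal on the \<open>G s\<close>, which makes
  them independent. There are at least as many of them as monomials of degree \<open>d\<close>, so
  they span the forms, and evaluating at \<open>p s\<close> reads off each coefficient.\<close>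

lemma form_interpolation:
  fixes G :: "'i \<Rightarrow> ('x::finite, 'k::field) mpol"
  assumes S: "finite S" "card S = (CARD('x) + d - 1) choose d"
    and G: "\<And>s. s \<in> S \<Longrightarrow> form d (G s)"
    and diag: "\<And>s t. s \<in> S \<Longrightarrow> t \<in> S \<Longrightarrow> mpol_eval (G s) (p t) = 0 \<longleftrightarrow> s \<noteq> t"
    and F: "form d F"
  shows "F = (\<Sum>s\<in>S. mpol_const (mpol_eval F (p s) / mpol_eval (G s) (p s)) * G s)"
proof -
  interpret vector_space "\<lambda>c F. mpol_const c * (F :: ('x, 'k) mpol)"
    by (rule vector_space_mpol)
  define M :: "('x \<Rightarrow>\<^sub>0 nat) set" where "M = {m. (\<Sum>i\<in>UNIV. Poly_Mapping.lookup m i) = d}"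
  define T :: "('x, 'k) mpol set" where "T = (\<lambda>m. Poly_Mapping.single m 1) ` M"
  have M: "finite M" "card M \<le> card S"
    unfolding M_def S(2) by (rule card_monomials_le)+
  have T: "finite T" "card T \<le> card S"
    unfolding T_def using M card_image_le order_trans by blast+
  have in_span: "F \<in> span T" if "form d F" for F
  proof -
    have "(\<Sum>m\<in>Poly_Mapping.keys F. mpol_const (Poly_Mapping.lookup F m) * Poly_Mapping.single m 1) \<in> span T"
      using that by (intro span_sum span_scale span_base) (auto simp: T_def M_def form_def)
    then show ?thesis
      by (simp add: mult_single flip: mpol_eq_sum_monomials)
  qed
  have inj: "inj_on G S"
    using diag by (metis inj_onI)
  have eval: "mpol_eval (\<Sum>s\<in>S. mpol_const (c s) * G s) (p t) = c t * mpol_eval (G t) (p t)"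
    if "t \<in> S" for c t
    by (rule mpol_eval_sum_diagonal) (use that S diag in auto)
  have indep: "independent (G ` S)"
  proof (rule independent_if_scalars_zero)
    fix f x assume "(\<Sum>x\<in>G ` S. mpol_const (f x) * x) = 0" and "x \<in> G ` S"
    then obtain s where s: "s \<in> S" "x = G s" and "(\<Sum>s\<in>S. mpol_const (f (G s)) * G s) = 0"
      using inj by (auto simp: sum.reindex)
    then have "f (G s) * mpol_eval (G s) (p s) = 0"
      using eval[of s "\<lambda>s. f (G s)"] mpol_eval_0[of "p s"] by simp
    then show "f x = 0"
      using s diag[of s s] by simp
  qed (use S in simp)
  have "F \<in> span (G ` S)"
  proof (rule ccontr)
    \<comment> \<open>Otherwise \<open>card S + 1\<close> independent forms would lie in the span of
      at most \<open>card S\<close> monomials.\<close>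
    assume F_notin: "F \<notin> span (G ` S)"
    then have "independent (insert F (G ` S))"
      using indep by (simp add: independent_insert)
    moreover have "insert F (G ` S) \<subseteq> span T"
      using F G in_span by auto
    ultimately have "card (insert F (G ` S)) \<le> card T"
      using independent_span_bound T(1) by blast
    moreover have "F \<notin> G ` S"
      using F_notin span_base by blast
    ultimately show False
      using T(2) S(1) inj by (simp add: card_image)
  qed
  then obtain u where u: "F = (\<Sum>s\<in>S. mpol_const (u (G s)) * G s)"
    using S(1) inj by (auto simp: span_finite sum.reindex)
  have "u (G s) = mpol_eval F (p s) / mpol_eval (G s) (p s)" if "s \<in> S" for s
    using eval[OF that, of "\<lambda>s. u (G s)", folded u] that diag[of s s] by (simp add: eq_divide_eq)
  then show ?thesis
    by (subst u, intro sum.cong) auto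
qed

section \<open>Hilbert functions\<close>

lemma subfield_constants: "subfield (range mpol_const) (mpol_ring :: ('x, 'k::field) mpol ring)"
proof (rule mpol.subfieldI)
  let ?K = "range mpol_const :: ('x, 'k) mpol set"
  have "subring ?K mpol_ring"
  proof (rule mpol.subringI)
    show "\<ominus>\<^bsub>mpol_ring\<^esub> h \<in> ?K" if "h \<in> ?K" for h
      using that by (auto simp: mpol_uminus simp flip: single_uminus)
    show "1 \<in> ?K"
      by (rule range_eqI[of _ _ 1]) simp
  qed (auto simp flip: mpol_const_mult single_add)
  then show "subcring ?K mpol_ring"
    by (rule mpol.subcringI) (simp add: mpol_ring_def mult.commute)
  show "Units (mpol_ring\<lparr>carrier := ?K\<rparr>) = ?K - {0}"
  proof safe
    fix x assume "x \<in> Units (mpol_ring\<lparr>carrier := ?K\<rparr>)"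
    then show "x \<in> ?K"
      by (auto simp: Units_def)
  next
    assume "0 \<in> Units (mpol_ring\<lparr>carrier := ?K\<rparr>)"
    then show False
      by (auto simp: Units_def mpol_ring_def)
  next
    fix c :: 'k assume "mpol_const c \<notin> Units (mpol_ring\<lparr>carrier := ?K\<rparr>)"
    moreover have "mpol_const c \<in> Units (mpol_ring\<lparr>carrier := ?K\<rparr>)" if "c \<noteq> 0"
    proof -
      have "mpol_const (inverse c) * mpol_const c = 1" "mpol_const c * mpol_const (inverse c) = 1"
        using that by (simp_all add: mult_single)
      then show ?thesis
        unfolding Units_def mpol_ring_def by auto
    qed
    ultimately show "mpol_const c = 0"
      by fastforce
  qed
qed

text \<open>A basis criterion that reduces the ring-theoretic dimension to congruences of forms
  modulo \<open>I\<close>. As \<open>1 \<notin> I\<close>, the image of the constants is again a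
  field, so the dimension is well defined.\<close>

lemma quotient_dim_eqI:
  fixes I :: "('x::finite, 'k::field) mpol set"
  assumes I: "ideal I mpol_ring" "1 \<notin> I" and S: "finite S"
    and G: "\<And>s. s \<in> S \<Longrightarrow> form d (G s)"
    and spanning: "\<And>F. form d F \<Longrightarrow> \<exists>c. F - (\<Sum>s\<in>S. mpol_const (c s) * G s) \<in> I"
    and indep: "\<And>c s. (\<Sum>s\<in>S. mpol_const (c s) * G s) \<in> I \<Longrightarrow> s \<in> S \<Longrightarrow> c s = 0"
  shows "quotient_dim I d = card S"
proof -
  interpret I: ideal I "mpol_ring :: ('x, 'k) mpol ring" by fact
  let ?Q = "mpol_ring Quot I" and ?\<pi> = "\<lambda>F. I +>\<^bsub>mpol_ring\<^esub> F"
  let ?K = "?\<pi> ` range mpol_const"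
  interpret \<pi>: ring_hom_ring "mpol_ring :: ('x, 'k) mpol ring" ?Q ?\<pi>
    by (rule I.rcos_ring_hom_ring)
  have carrier: "F \<in> carrier mpol_ring" for F :: "('x, 'k) mpol"
    by (simp add: mpol_ring_simps)
  have minus: "F \<ominus>\<^bsub>mpol_ring\<^esub> G = F - G" for F G :: "('x, 'k) mpol"
    by (simp add: a_minus_def mpol_uminus mpol_ring_simps)
  have \<pi>_eq: "?\<pi> F = ?\<pi> G \<longleftrightarrow> F - G \<in> I" for F G
    using mpol.quotient_eq_iff_same_a_r_cos[OF I(1), of F G] minus[of F G]
    by (auto simp: carrier)
  have \<pi>_add: "?\<pi> (F + G) = ?\<pi> F \<oplus>\<^bsub>?Q\<^esub> ?\<pi> G" for F G
    using \<pi>.hom_add[OF carrier carrier, of F G] by (simp add: mpol_ring_simps)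
  have \<pi>_mult: "?\<pi> (F * G) = ?\<pi> F \<otimes>\<^bsub>?Q\<^esub> ?\<pi> G" for F G
    using \<pi>.hom_mult[OF carrier carrier, of F G] by (simp add: mpol_ring_simps)
  have zero: "?\<pi> 0 = \<zero>\<^bsub>?Q\<^esub>"
    using \<pi>.hom_zero by (simp add: mpol_ring_simps)
  have one: "?\<pi> 1 = \<one>\<^bsub>?Q\<^esub>"
    using \<pi>.hom_one by (simp add: mpol_ring_simps)
  have K: "subfield ?K ?Q"
    using \<pi>_eq[of 1 0] I(2) zero one
    by (intro \<pi>.img_is_subfield(2) subfield_constants) simp_all
  \<comment> \<open>The inductive predicate \<open>dimension\<close> grows by one line at a time, so
    the family is built up over subsets \<open>U\<close> of \<open>S\<close>.\<close>
  have "\<pi>.S.dimension (card U) ?K (range (\<lambda>c. ?\<pi> (\<Sum>s\<in>U. mpol_const (c s) * G s)))"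
    if "finite U" "U \<subseteq> S" for U
    using that
  proof (induction U rule: finite_induct)
    case empty
    show ?case
      using zero \<pi>.S.dimension.zero_dim by simp
  next
    case (insert a U)
    let ?E = "\<lambda>U. range (\<lambda>c. ?\<pi> (\<Sum>s\<in>U. mpol_const (c s) * G s))"
    have sum_upd: "(\<Sum>s\<in>insert a U. mpol_const ((c(a := k)) s) * G s) =
        mpol_const k * G a + (\<Sum>s\<in>U. mpol_const (c s) * G s)" for c k
      using insert.hyps by (auto intro!: sum.cong)
    have "?\<pi> (G a) \<notin> ?E U"
    proof
      assume "?\<pi> (G a) \<in> ?E U"
      then obtain c where c: "G a - (\<Sum>s\<in>U. mpol_const (c s) * G s) \<in> I"
        unfolding image_iff \<pi>_eq by blast
      \<comment> \<open>The congruence for \<open>G a\<close> becomes a relation over all of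
        \<open>S\<close> with coefficient 1 at \<open>a\<close>, extended by zero outside
        \<open>insert a U\<close>.\<close>
      let ?c = "\<lambda>s. if s \<in> insert a U then ((\<lambda>s. - c s)(a := 1)) s else 0"
      have "(\<Sum>s\<in>S. mpol_const (?c s) * G s) = (\<Sum>s\<in>insert a U. mpol_const (?c s) * G s)"
        by (rule sum.mono_neutral_right) (use insert.prems S in auto)
      also have "\<dots> = (\<Sum>s\<in>insert a U. mpol_const (((\<lambda>s. - c s)(a := 1)) s) * G s)"
        by (rule sum.cong) auto
      also have "\<dots> = G a - (\<Sum>s\<in>U. mpol_const (c s) * G s)"
        unfolding sum_upd by (simp add: sum_negf single_uminus)
      finally have "?c a = 0"
        using c insert.prems by (intro indep) auto
      then show False by simp
    qed
    then have "\<pi>.S.dimension (Suc (card U)) ?K (\<pi>.S.line_extension ?K (?\<pi> (G a)) (?E U))"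
      using insert carrier by (intro \<pi>.S.dimension.Suc_dim) auto
    also have "\<pi>.S.line_extension ?K (?\<pi> (G a)) (?E U) = ?E (insert a U)"
    proof (intro equalityI subsetI)
      fix u assume "u \<in> \<pi>.S.line_extension ?K (?\<pi> (G a)) (?E U)"
      then obtain k c where "u = ?\<pi> (mpol_const k) \<otimes>\<^bsub>?Q\<^esub> ?\<pi> (G a) \<oplus>\<^bsub>?Q\<^esub>
          ?\<pi> (\<Sum>s\<in>U. mpol_const (c s) * G s)"
        unfolding \<pi>.S.line_extension_mem_iff by blast
      then have "u = ?\<pi> (\<Sum>s\<in>insert a U. mpol_const ((c(a := k)) s) * G s)"
        unfolding sum_upd \<pi>_add \<pi>_mult .
      then show "u \<in> ?E (insert a U)" by blast
    next
      fix u assume "u \<in> ?E (insert a U)"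
      then obtain c where "u = ?\<pi> (\<Sum>s\<in>insert a U. mpol_const (c s) * G s)"
        by blast
      then have "u = ?\<pi> (mpol_const (c a)) \<otimes>\<^bsub>?Q\<^esub> ?\<pi> (G a) \<oplus>\<^bsub>?Q\<^esub>
          ?\<pi> (\<Sum>s\<in>U. mpol_const (c s) * G s)"
        using insert.hyps by (simp add: \<pi>_add \<pi>_mult)
      then show "u \<in> \<pi>.S.line_extension ?K (?\<pi> (G a)) (?E U)"
        unfolding \<pi>.S.line_extension_mem_iff by blast
    qed
    finally show ?case
      using insert.hyps by simp
  qed
  from this[OF S order_refl]
  have "\<pi>.S.dimension (card S) ?K (range (\<lambda>c. ?\<pi> (\<Sum>s\<in>S. mpol_const (c s) * G s)))" .
  also have "range (\<lambda>c. ?\<pi> (\<Sum>s\<in>S. mpol_const (c s) * G s)) = ?\<pi> ` {F. form d F}"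
  proof (intro equalityI subsetI)
    fix u assume "u \<in> range (\<lambda>c. ?\<pi> (\<Sum>s\<in>S. mpol_const (c s) * G s))"
    then show "u \<in> ?\<pi> ` {F. form d F}"
      by (auto intro!: imageI form_sum form_const_mult G)
  next
    fix u assume "u \<in> ?\<pi> ` {F. form d F}"
    then obtain F c where "u = ?\<pi> F" "F - (\<Sum>s\<in>S. mpol_const (c s) * G s) \<in> I"
      using spanning by blast
    then show "u \<in> range (\<lambda>c. ?\<pi> (\<Sum>s\<in>S. mpol_const (c s) * G s))"
      by (intro range_eqI[of _ _ c]) (simp only: \<pi>_eq)
  qed
  finally show ?thesis
    using \<pi>.S.dimI[OF K] by (simp add: quotient_dim_def over_def image_image)
qed

text \<open>The quotient is the zero ring, where the constants form no field and the criterion above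
  does not apply. The dimension is therefore computed from its inductive definition.\<close>

lemma quotient_dim_UNIV: "quotient_dim (UNIV :: ('x::finite, 'k::field) mpol set) d = 0"
proof -
  let ?R = "mpol_ring :: ('x, 'k) mpol ring"
  let ?Q = "?R Quot UNIV"
  have "ideal UNIV ?R"
    by (rule mpol.oneideal)
  then interpret I: ideal UNIV ?R .
  interpret Q: ring ?Q
    by (rule I.quotient_is_ring)
  have coset: "UNIV +>\<^bsub>?R\<^esub> F = UNIV" for F
    by (rule I.a_rcos_const) simp
  have carrier: "carrier ?Q = {UNIV}" and zero: "\<zero>\<^bsub>?Q\<^esub> = UNIV"
    by (auto simp: FactRing_def A_RCOSETS_def' coset)
  \<comment> \<open>A line extension would require a vector outside \<open>{UNIV}\<close>, which is
    already the whole carrier.\<close>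
  have "n = 0 \<and> E = {UNIV}" if "Q.dimension n K E" for n K E
    using that by (induction rule: Q.dimension.induct) (use carrier zero in auto)
  then have "Q.dim K {UNIV} = 0" for K
    unfolding Q.dim_def using Q.dimension.zero_dim zero by (metis the_equality)
  moreover have "(\<lambda>F. UNIV) ` {F :: ('x, 'k) mpol. form d F} = {UNIV :: ('x, 'k) mpol set}"
    using form_0 by (auto intro!: image_eqI[of _ _ 0])
  ultimately show ?thesis
    by (simp add: quotient_dim_def coset)
qed

section \<open>Ideals of sets of points\<close>

lemma ideal_vanishing: "ideal {F. \<forall>a\<in>P. mpol_eval F a = 0} mpol_ring"
proof (rule idealI[OF mpol.ring_axioms])
  show "subgroup {F. \<forall>a\<in>P. mpol_eval F a = 0} (add_monoid mpol_ring)"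
  proof (rule subgroup.intro)
    fix F assume "F \<in> {F. \<forall>a\<in>P. mpol_eval F a = 0}"
    then have "\<ominus>\<^bsub>mpol_ring\<^esub> F \<in> {F. \<forall>a\<in>P. mpol_eval F a = 0}"
      using mpol_eval_diff[of 0 F] by (simp add: mpol_uminus mpol_eval_0)
    then show "inv\<^bsub>add_monoid mpol_ring\<^esub> F \<in> {F. \<forall>a\<in>P. mpol_eval F a = 0}"
      by (simp only: a_inv_def)
  qed (auto simp: mpol_ring_simps mpol_eval_add mpol_eval_0)
qed (auto simp: mpol_ring_simps mpol_eval_mult)

lemma ideal_points_ideal: "ideal (points_ideal X) mpol_ring"
proof (cases "X = {}")
  \<comment> \<open>The empty intersection is the whole ring.\<close>
  case True
  then show ?thesis
    using mpol.oneideal by (simp add: points_ideal_def)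
next
  case False
  then show ?thesis
    unfolding points_ideal_def
    by (intro mpol.i_Intersect) (auto simp: point_ideal_def intro!: mpol.genideal_ideal)
qed

text \<open>Every generator of \<open>point_ideal P\<close> vanishes on \<open>P\<close>, hence so
  does the whole ideal; conversely a form that vanishes on \<open>P\<close> is itself a
  generator.\<close>

lemma form_in_points_ideal_iff:
  assumes "form d F"
  shows "F \<in> points_ideal X \<longleftrightarrow> (\<forall>P\<in>X. \<forall>a\<in>P. mpol_eval F a = 0)"
proof -
  have "F \<in> point_ideal P \<longleftrightarrow> (\<forall>a\<in>P. mpol_eval F a = 0)" for P
  proof
    have "point_ideal P \<subseteq> {F. \<forall>a\<in>P. mpol_eval F a = 0}"
      unfolding point_ideal_def by (rule mpol.genideal_minimal[OF ideal_vanishing]) auto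
    then show "\<forall>a\<in>P. mpol_eval F a = 0" if "F \<in> point_ideal P"
      using that by auto
    show "F \<in> point_ideal P" if "\<forall>a\<in>P. mpol_eval F a = 0"
      unfolding point_ideal_def
      by (rule subsetD[OF mpol.genideal_self]) (use assms that in auto)
  qed
  then show ?thesis
    by (simp add: points_ideal_def)
qed

lemma form_in_points_ideal_iff_representatives:
  assumes "form d F"
  shows "F \<in> points_ideal ((\<lambda>s. range (\<lambda>c. c *s p s)) ` S) \<longleftrightarrow> (\<forall>s\<in>S. mpol_eval F (p s) = 0)"
  by (simp add: form_in_points_ideal_iff[OF assms] form_vanishes_on_line_iff[OF assms])

section \<open>Star configurations and complements of Steiner configurations\<close>

lemma finite_subsets_of_card: "finite (subsets_of_card n v)"
  unfolding subsets_of_card_def by simp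

lemma card_subsets_of_card: "card (subsets_of_card n v) = v choose n"
  unfolding subsets_of_card_def using n_subsets[of "{1..v}" n] by simp

lemma subsets_of_card_mono: "m \<le> v \<Longrightarrow> subsets_of_card n m \<subseteq> subsets_of_card n v"
  unfolding subsets_of_card_def by force

text \<open>Hyperplanes are replaced by linear forms and points by representative vectors. The
  assumption \<open>incidence\<close> carries both halves of \<open>meet_properly\<close>: the point
  of \<open>s\<close> lies on the hyperplanes indexed by \<open>s\<close> and on no others.\<close>

locale star_configuration =
  fixes n v :: nat
    and l :: "nat \<Rightarrow> ('x::finite, 'k::field) mpol"
    and p :: "nat set \<Rightarrow> 'k ^ 'x"
  assumes CARD: "CARD('x) = n + 1"
    and form_l: "\<And>i. i \<in> {1..v} \<Longrightarrow> form 1 (l i)"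
    and incidence: "\<And>s i. s \<in> subsets_of_card n v \<Longrightarrow> i \<in> {1..v} \<Longrightarrow> mpol_eval (l i) (p s) = 0 \<longleftrightarrow> i \<in> s"
    and p_nonzero: "\<And>s. s \<in> subsets_of_card n v \<Longrightarrow> p s \<noteq> 0"
begin

definition complement_prod :: "nat \<Rightarrow> nat set \<Rightarrow> ('x, 'k) mpol" where
  "complement_prod m s = (\<Prod>i\<in>{1..m} - s. l i)"

lemma form_complement_prod:
  assumes "m \<le> v" "s \<in> subsets_of_card n m"
  shows "form (m - n) (complement_prod m s)"
proof -
  have "card ({1..m} - s) = m - n"
    using assms by (subst card_Diff_subset) (auto simp: subsets_of_card_def finite_subset)
  moreover have "form (card ({1..m} - s)) (complement_prod m s)"
    unfolding complement_prod_def using assms by (intro form_prod form_l) auto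
  ultimately show ?thesis by simp
qed

text \<open>A factor \<open>l i\<close> vanishes at \<open>p t\<close> exactly when
  \<open>i \<in> t\<close>. Since \<open>t\<close> may have elements beyond \<open>m\<close>, this
  also covers the points needed to isolate a block's coefficient.\<close>

lemma eval_complement_prod_eq_0_iff:
  assumes "m \<le> v" "t \<in> subsets_of_card n v"
  shows "mpol_eval (complement_prod m s) (p t) = 0 \<longleftrightarrow> \<not> t \<inter> {1..m} \<subseteq> s"
  using assms incidence[OF assms(2)] by (force simp: complement_prod_def mpol_eval_prod)

lemma eval_complement_prod_diagonal:
  assumes "m \<le> v" "s \<in> subsets_of_card n m" "t \<in> subsets_of_card n m"
  shows "mpol_eval (complement_prod m s) (p t) = 0 \<longleftrightarrow> s \<noteq> t"
proof -
  have "t \<inter> {1..m} \<subseteq> s \<longleftrightarrow> s = t"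
    using assms card_subset_eq[of s t]
    by (auto simp: subsets_of_card_def finite_subset Int_absorb2)
  then show ?thesis
    using assms subsets_of_card_mono by (subst eval_complement_prod_eq_0_iff) auto
qed

lemma form_eq_sum_complement_prods:
  assumes "n + d \<le> v" "form d F"
  shows "F = (\<Sum>s\<in>subsets_of_card n (n + d).
    mpol_const (mpol_eval F (p s) / mpol_eval (complement_prod (n + d) s) (p s)) * complement_prod (n + d) s)"
proof (rule form_interpolation)
  show "card (subsets_of_card n (n + d)) = CARD('x) + d - 1 choose d"
    using binomial_symmetric[of n "n + d"] by (simp add: card_subsets_of_card CARD)
  show "form d (complement_prod (n + d) s)" if "s \<in> subsets_of_card n (n + d)" for s
    using form_complement_prod[OF assms(1) that] by simp
qed (use assms eval_complement_prod_diagonal finite_subsets_of_card in auto)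

end

section \<open>The complement of a Steiner configuration and its Hilbert function\<close>

locale star_configuration_complement = star_configuration n v l p
  for n v and l :: "nat \<Rightarrow> ('x::finite, 'k::field) mpol" and p +
  fixes B :: "nat set set"
  assumes n_pos: "n > 0" and n_less_v: "n < v"
    and B: "B \<subseteq> subsets_of_card n v"
    and block_unique: "\<And>b b' T. b \<in> B \<Longrightarrow> b' \<in> B \<Longrightarrow> card T = n - 1 \<Longrightarrow> T \<subseteq> b \<Longrightarrow> T \<subseteq> b' \<Longrightarrow> b = b'"
begin

definition C :: "nat set set" where
  "C = subsets_of_card n v - B"

definition X :: "('k ^ 'x) set set" where
  "X = (\<lambda>s. range (\<lambda>c. c *s p s)) ` C"

lemma form_vanishing_on_complement_eq_0:
  assumes d: "n + d < v" and F: "form d F" and vanish: "\<And>s. s \<in> C \<Longrightarrow> mpol_eval F (p s) = 0"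
  shows "F = 0"
proof -
  define m where "m = n + d"
  have m: "m < v" "m \<le> v"
    using d by (auto simp: m_def)
  define c where "c s = mpol_eval F (p s) / mpol_eval (complement_prod m s) (p s)" for s
  have F_eq: "F = (\<Sum>s\<in>subsets_of_card n m. mpol_const (c s) * complement_prod m s)"
    unfolding c_def m_def by (rule form_eq_sum_complement_prods) (use d F in auto)
  have sub: "subsets_of_card n m \<subseteq> subsets_of_card n v"
    using m subsets_of_card_mono by blast
  \<comment> \<open>Here \<open>s \<in> C\<close>, so the numerator of \<open>c s\<close> is
    zero.\<close>
  have c_0: "c s = 0" if "s \<in> subsets_of_card n m" "s \<notin> B" for s
    unfolding c_def using that sub vanish by (auto simp: C_def)
  have "c s = 0" if s: "s \<in> subsets_of_card n m" "s \<in> B" for s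
  proof -
    have s': "s \<subseteq> {1..m}" "card s = n" "finite s"
      using s by (auto simp: subsets_of_card_def finite_subset)
    then obtain T where T: "T \<subseteq> s" "card T = n - 1" "finite T"
      by (metis obtain_subset_with_card_n diff_le_self)
    \<comment> \<open>This fits into \<open>{1..v}\<close> because \<open>m < v\<close>. It shares
      \<open>T\<close> with the block \<open>s\<close> but differs from \<open>s\<close>, so it is
      no block and \<open>F\<close> vanishes at its point.\<close>
    let ?q = "insert (Suc m) T"
    have "Suc m \<notin> T" "Suc m \<notin> s"
      using T(1) s'(1) by auto
    then have q: "?q \<in> subsets_of_card n v"
      using T s' m n_pos by (auto simp: subsets_of_card_def)
    have "?q \<notin> B"
      using block_unique[OF s(2) _ T(2) T(1), of ?q] \<open>Suc m \<notin> s\<close> by blast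
    then have "mpol_eval F (p ?q) = 0"
      using q vanish by (auto simp: C_def)
    moreover have "mpol_eval F (p ?q) = c s * mpol_eval (complement_prod m s) (p ?q)"
    proof -
      have "mpol_eval F (p ?q) = (\<Sum>u\<in>subsets_of_card n m. c u * mpol_eval (complement_prod m u) (p ?q))"
        by (subst F_eq) (simp add: mpol_eval_sum mpol_eval_mult mpol_eval_const)
      also have "\<dots> = (\<Sum>u\<in>{s}. c u * mpol_eval (complement_prod m u) (p ?q))"
      proof (rule sum.mono_neutral_right)
        show "\<forall>u\<in>subsets_of_card n m - {s}. c u * mpol_eval (complement_prod m u) (p ?q) = 0"
        proof
          fix u assume u: "u \<in> subsets_of_card n m - {s}"
          show "c u * mpol_eval (complement_prod m u) (p ?q) = 0"
          proof (cases "u \<in> B")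
            case True
            then have "\<not> T \<subseteq> u"
              using block_unique[OF s(2) _ T(2) T(1)] u by blast
            then have "\<not> ?q \<inter> {1..m} \<subseteq> u"
              using T(1) s'(1) by blast
            then show ?thesis
              using eval_complement_prod_eq_0_iff[OF m(2) q] by simp
          qed (use u c_0 in auto)
        qed
      qed (use s finite_subsets_of_card in auto)
      finally show ?thesis by simp
    qed
    \<comment> \<open>Within \<open>{1..m}\<close> the set \<open>?q\<close> is just
      \<open>T\<close>, which lies in \<open>s\<close>.\<close>
    moreover have "mpol_eval (complement_prod m s) (p ?q) \<noteq> 0"
      using T(1) eval_complement_prod_eq_0_iff[OF m(2) q] by auto
    ultimately show ?thesis by simp
  qed
  then have "c s = 0" if "s \<in> subsets_of_card n m" for s
    using that c_0 by blast
  then show ?thesis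
    by (subst F_eq) (simp add: sum.neutral)
qed

text \<open>As \<open>n < v\<close>, the preceding lemma applies in degree 0 and would force the
  constant 1 to be zero.\<close>

lemma points_ideal_proper: "1 \<notin> points_ideal X"
proof
  assume "1 \<in> points_ideal X"
  then have "(1 :: ('x, 'k) mpol) = 0"
    using n_less_v form_const[of 1]
    by (intro form_vanishing_on_complement_eq_0[of 0])
      (auto simp: X_def form_in_points_ideal_iff_representatives[of 0])
  then show False by simp
qed

lemma hilbert_fun_small:
  assumes "n + d < v"
  shows "hilbert_fun X d = (n + d) choose n"
proof -
  let ?S = "subsets_of_card n (n + d)" and ?M = "complement_prod (n + d)"
  have form_M: "form d (?M s)" if "s \<in> ?S" for s
    using form_complement_prod[OF _ that] assms by simp
  have "quotient_dim (points_ideal X) d = card ?S"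
  proof (rule quotient_dim_eqI[OF ideal_points_ideal points_ideal_proper finite_subsets_of_card form_M])
    fix F :: "('x, 'k) mpol" assume F: "form d F"
    define c where "c s = mpol_eval F (p s) / mpol_eval (?M s) (p s)" for s
    have "F - (\<Sum>s\<in>?S. mpol_const (c s) * ?M s) = 0"
      unfolding c_def using form_eq_sum_complement_prods[OF _ F] assms by simp
    moreover have "0 \<in> points_ideal X"
      by (simp add: form_in_points_ideal_iff[OF form_0] mpol_eval_0)
    ultimately show "\<exists>c. F - (\<Sum>s\<in>?S. mpol_const (c s) * ?M s) \<in> points_ideal X"
      by metis
  next
    fix c s assume sum: "(\<Sum>s\<in>?S. mpol_const (c s) * ?M s) \<in> points_ideal X" and s: "s \<in> ?S"
    have "form d (\<Sum>s\<in>?S. mpol_const (c s) * ?M s)"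
      by (intro form_sum form_const_mult form_M)
    then have "(\<Sum>s\<in>?S. mpol_const (c s) * ?M s) = 0"
      using sum assms
      by (intro form_vanishing_on_complement_eq_0) (auto simp: X_def form_in_points_ideal_iff_representatives)
    then have "mpol_eval (\<Sum>s\<in>?S. mpol_const (c s) * ?M s) (p s) = 0"
      by (simp add: mpol_eval_0)
    moreover have "mpol_eval (\<Sum>s\<in>?S. mpol_const (c s) * ?M s) (p s) = c s * mpol_eval (?M s) (p s)"
      by (rule mpol_eval_sum_diagonal) (use s assms eval_complement_prod_diagonal finite_subsets_of_card in auto)
    ultimately show "c s = 0"
      using s assms eval_complement_prod_diagonal[of "n + d" s s] by auto
  qed
  then show ?thesis
    by (simp add: hilbert_fun_def card_subsets_of_card)
qed

text \<open>Each point of \<open>X\<close> has a form of degree \<open>d\<close> that is nonzero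
  there and zero at all the others, so evaluation identifies the degree \<open>d\<close> part of the
  quotient with the functions on \<open>C\<close>.\<close>

lemma hilbert_fun_large:
  assumes "v \<le> n + d"
  shows "hilbert_fun X d = card C"
proof -
  \<comment> \<open>The degree missing from \<open>complement_prod v s\<close>; the subtraction is
    exact since \<open>v - n \<le> d\<close>.\<close>
  define e where "e = d - (v - n)"
  have "\<exists>j. p s $ j \<noteq> 0" if "s \<in> subsets_of_card n v" for s
    using p_nonzero[OF that] by (auto simp: vec_eq_iff)
  then obtain j where j: "p s $ j s \<noteq> 0" if "s \<in> subsets_of_card n v" for s
    by metis
  \<comment> \<open>A coordinate that is nonzero at \<open>p s\<close>, so its powers raise the
    degree without losing nonvanishing there.\<close>
  define y :: "nat set \<Rightarrow> ('x, 'k) mpol" where "y s = lin_form (axis (j s) 1)" for s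
  have eval_y: "mpol_eval (y s) (p s) = p s $ j s" for s
  proof -
    have "mpol_eval (y s) (p s) = (\<Sum>i\<in>UNIV. if i = j s then p s $ i else 0)"
      unfolding y_def mpol_eval_lin_form by (rule sum.cong) (auto simp: axis_def)
    then show ?thesis by simp
  qed
  have form_y: "form 1 (y s)" for s
    unfolding y_def lin_form_def
    by (rule form_sum) (auto simp: form_def lookup_single when_def)
  have form_pow: "form e (y s ^ e)" for s
    using form_prod[of "{..<e}" "\<lambda>_. y s"] form_y by simp
  define G where "G s = complement_prod v s * y s ^ e" for s
  have form_G: "form d (G s)" if "s \<in> C" for s
    using form_mult[OF form_complement_prod form_pow, of v s s] that assms n_less_v
    by (simp add: G_def e_def C_def)
  have eval_pow: "mpol_eval (y s ^ e) a = mpol_eval (y s) a ^ e" for s a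
    using mpol_eval_prod[of "\<lambda>_. y s" "{..<e}" a] by simp
  have diag: "mpol_eval (G s) (p s) \<noteq> 0" if "s \<in> C" for s
    using that eval_complement_prod_diagonal[of v s s] j[of s]
    by (auto simp: G_def C_def mpol_eval_mult eval_pow eval_y)
  have off_diag: "mpol_eval (G s) (p t) = 0" if "s \<in> C" "t \<in> C" "s \<noteq> t" for s t
    using that eval_complement_prod_diagonal[of v s t] by (auto simp: G_def C_def mpol_eval_mult)
  have finite_C: "finite C"
    unfolding C_def using finite_subsets_of_card by blast
  have eval_sum: "mpol_eval (\<Sum>s\<in>C. mpol_const (c s) * G s) (p t) = c t * mpol_eval (G t) (p t)"
    if "t \<in> C" for c t
    by (rule mpol_eval_sum_diagonal) (use that finite_C off_diag in auto)
  have form_combination: "form d (\<Sum>s\<in>C. mpol_const (c s) * G s)" for c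
    by (intro form_sum form_const_mult form_G)
  have "quotient_dim (points_ideal X) d = card C"
  proof (rule quotient_dim_eqI[OF ideal_points_ideal points_ideal_proper finite_C form_G])
    fix F :: "('x, 'k) mpol" assume F: "form d F"
    define c where "c s = mpol_eval F (p s) / mpol_eval (G s) (p s)" for s
    have "F - (\<Sum>s\<in>C. mpol_const (c s) * G s) \<in> points_ideal X"
      unfolding X_def form_in_points_ideal_iff_representatives[OF form_diff[OF F form_combination]]
      using diag by (simp add: mpol_eval_diff eval_sum c_def)
    then show "\<exists>c. F - (\<Sum>s\<in>C. mpol_const (c s) * G s) \<in> points_ideal X" by blast
  next
    fix c s assume "(\<Sum>s\<in>C. mpol_const (c s) * G s) \<in> points_ideal X" "s \<in> C"
    then have "mpol_eval (\<Sum>s\<in>C. mpol_const (c s) * G s) (p s) = 0"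
      unfolding X_def form_in_points_ideal_iff_representatives[OF form_combination] by blast
    then show "c s = 0"
      using eval_sum diag \<open>s \<in> C\<close> by simp
  qed
  then show ?thesis
    by (simp add: hilbert_fun_def)
qed

section \<open>Bounding the number of blocks\<close>

lemma finite_B: "finite B"
  using B finite_subsets_of_card finite_subset by blast

text \<open>Double counting: a pair of a block \<open>b\<close> and \<open>x \<in> b\<close> is sent
  to \<open>b - {x}\<close>. This set has \<open>n - 1\<close> elements, so it determines
  \<open>b\<close> and then \<open>x\<close>.\<close>

lemma n_times_card_B_le: "n * card B \<le> v choose (n - 1)"
proof -
  have fin: "finite b" if "b \<in> B" for b
    using that B by (auto simp: subsets_of_card_def finite_subset)
  have card_b: "card b = n" if "b \<in> B" for b
    using that B by (auto simp: subsets_of_card_def)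
  let ?f = "\<lambda>(b, x). b - {x}"
  have card_f: "card (b - {x}) = n - 1" if "b \<in> B" "x \<in> b" for b x
    using that fin card_b by simp
  have inj: "inj_on ?f (SIGMA b:B. b)"
  proof (rule inj_onI, clarsimp)
    fix b x b' x' assume *: "b \<in> B" "x \<in> b" "b' \<in> B" "x' \<in> b'" "b - {x} = b' - {x'}"
    then have "b = b'"
      using block_unique[of b b' "b - {x}"] card_f by blast
    then show "b = b' \<and> x = x'"
      using * by blast
  qed
  have "n * card B = card (SIGMA b:B. b)"
    using finite_B fin card_b by (simp add: card_SigmaI)
  also have "\<dots> = card (?f ` (SIGMA b:B. b))"
    using inj by (simp add: card_image)
  also have "\<dots> \<le> card (subsets_of_card (n - 1) v)"
  proof (rule card_mono[OF finite_subsets_of_card])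
    show "?f ` (SIGMA b:B. b) \<subseteq> subsets_of_card (n - 1) v"
      using B card_f by (fastforce simp: subsets_of_card_def)
  qed
  finally show ?thesis
    by (simp add: card_subsets_of_card)
qed

text \<open>This makes the last entry of the h-vector positive. For \<open>n = 1\<close> a single
  block would give equality.\<close>

lemma card_B_less:
  assumes "n \<ge> 2"
  shows "card B < (v - 1) choose (n - 1)"
proof -
  obtain k where k: "n = Suc (Suc k)"
    using assms by (metis add_2_eq_Suc le_Suc_ex)
  obtain w where w: "v = Suc w" "w \<ge> Suc (Suc k)"
    using n_less_v k by (cases v) auto
  \<comment> \<open>Absorption compares neighbouring binomials; \<open>w - k \<ge> 2\<close> then
    turns the double counting bound into a strict inequality after Pascal's rule for
    \<open>v choose (n - 1)\<close>.\<close>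
  have "Suc k * (w choose Suc k) = (w - k) * (w choose k)"
    using binomial_absorption[of k w] binomial_absorb_comp[of w k] by simp
  moreover have "2 * (w choose k) \<le> (w - k) * (w choose k)"
    using w by (intro mult_right_mono) auto
  moreover have "w choose k > 0"
    using w by simp
  ultimately have "w choose k < Suc k * (w choose Suc k)"
    by linarith
  then have "v choose (n - 1) < n * (w choose Suc k)"
    by (simp add: k w)
  then have "n * card B < n * (w choose Suc k)"
    using n_times_card_B_le by linarith
  then have "card B < w choose Suc k"
    by (rule mult_less_cancel1[THEN iffD1, THEN conjunct2])
  then show ?thesis
    by (simp add: k w)
qed

section \<open>The h-vector\<close>

lemma card_C: "card C = (v choose n) - card B"
  unfolding C_def using B finite_B by (simp add: card_Diff_subset card_subsets_of_card)

lemma h_vector_X: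
  assumes "n \<ge> 2"
  shows "h_vector X = map (\<lambda>i. int ((n - 1 + i) choose (n - 1))) [0..<v - n] @
    [int ((v - 1) choose (n - 1)) - int (card B)]"
proof -
  have pascal: "(m choose n) = ((m - 1) choose (n - 1)) + ((m - 1) choose n)" if "m > 0" for m
    using that n_pos by (rule choose_reduce_nat)
  have small: "delta_hilbert X d = int ((n - 1 + d) choose (n - 1))" if "d < v - n" for d
  proof (cases d)
    case 0
    then show ?thesis
      using hilbert_fun_small[of d] that by (simp add: delta_hilbert_def)
  next
    case (Suc d')
    then show ?thesis
      using hilbert_fun_small[of d] hilbert_fun_small[of d'] that pascal[of "n + d"] n_pos
      by (simp add: delta_hilbert_def)
  qed
  have last: "delta_hilbert X (v - n) = int ((v - 1) choose (n - 1)) - int (card B)"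
  proof -
    \<comment> \<open>Ensures that the natural subtraction in \<open>card_C\<close> is exact when
      passing to integers.\<close>
    have "card B \<le> v choose n"
      using B card_mono[OF finite_subsets_of_card] by (metis card_subsets_of_card)
    then show ?thesis
      using hilbert_fun_small[of "v - n - 1"] hilbert_fun_large[of "v - n"] n_less_v pascal[of v]
      by (simp add: delta_hilbert_def card_C)
  qed
  have large: "delta_hilbert X d = 0" if "d > v - n" for d
    using that hilbert_fun_large[of d] hilbert_fun_large[of "d - 1"] by (simp add: delta_hilbert_def)
  \<comment> \<open>Beyond \<open>v - n\<close> the Hilbert function is constant, and at
    \<open>v - n\<close> the difference is positive by \<open>card_B_less\<close>.\<close>
  have "Sup {d. delta_hilbert X d > 0} = v - n"
  proof (rule cSup_eq_maximum)
    show "v - n \<in> {d. delta_hilbert X d > 0}"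
      using card_B_less[OF assms] by (simp add: last)
    show "d \<le> v - n" if "d \<in> {d. delta_hilbert X d > 0}" for d
      using that large[of d] by (cases "d \<le> v - n") auto
  qed
  then show ?thesis
    by (simp add: h_vector_def last small)
qed

end

lemma h_vector_empty: "h_vector ({} :: ('k::field ^ 'x::finite) set set) = [0]"
proof -
  have "delta_hilbert ({} :: ('k ^ 'x) set set) d = 0" for d
    by (simp add: delta_hilbert_def hilbert_fun_def points_ideal_def quotient_dim_UNIV)
  then show ?thesis
    by (simp add: h_vector_def)
qed

theorem proposition4p1:
  fixes t n v :: nat
    and B :: "nat set set"
    and H :: "nat \<Rightarrow> ('k::field ^ 'x::finite) set set"
  assumes "CARD('x) = n + 1"
    and "n \<ge> 2"
    and "t < n" and "n \<le> v"
    and "steiner_system t n v B"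
    and "\<forall>j\<in>{1..v}. hyperplane (H j)"
    and "inj_on H {1..v}"
    and "meet_properly n v H"
  shows "h_vector (config_points H (subsets_of_card n v - B)) =
    map (\<lambda>i. int ((n - 1 + i) choose (n - 1))) [0..<v - n] @
    [int ((v - 1) choose (n - 1)) - int (card B)]"
proof -
  have B: "B \<subseteq> subsets_of_card n v"
    using assms(5) by (auto simp: steiner_system_def subsets_of_card_def)
  \<comment> \<open>Because \<open>t \<le> n - 1\<close>, such a \<open>T\<close> contains a
    \<open>t\<close>-subset, and that lies in only one block.\<close>
  have unique: "b = b'" if T: "b \<in> B" "b' \<in> B" "card T = n - 1" "T \<subseteq> b" "T \<subseteq> b'" for b b' T
  proof -
    have "t \<le> card T"
      using T(3) assms(3) by simp
    then obtain T' where "T' \<subseteq> T" "card T' = t"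
      by (rule obtain_subset_with_card_n)
    moreover from this have "T' \<subseteq> {1..v}"
      using T B unfolding subsets_of_card_def by blast
    ultimately show ?thesis
      using assms(5) T unfolding steiner_system_def by (metis subset_trans)
  qed
  show ?thesis
  proof (cases "v = n")
    \<comment> \<open>The only \<open>n\<close>-subset is a block, so the configuration is empty.
      Both sides are \<open>[0]\<close>: the left by the default \<open>Sup {} = 0\<close>, the
      right as \<open>1 - 1\<close>.\<close>
    case True
    have all: "subsets_of_card n v = {{1..n}}"
      using card_subset_eq[of "{1..n}"] by (auto simp: True subsets_of_card_def)
    obtain T :: "nat set" where "T \<subseteq> {1..v}" "card T = t"
      using obtain_subset_with_card_n[of t "{1..v}"] assms(3,4) by auto
    then have "B \<noteq> {}"
      using assms(5) unfolding steiner_system_def by blast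
    then have "B = {{1..n}}"
      using B unfolding all by blast
    then show ?thesis
      using all by (simp add: True config_points_def h_vector_empty)
  next
    case False
    have "\<forall>j\<in>{1..v}. \<exists>l. form 1 l \<and> H j = proj_zeros l"
      using assms(6) unfolding hyperplane_def by blast
    then obtain l where l: "\<And>j. j \<in> {1..v} \<Longrightarrow> form 1 (l j)" "\<And>j. j \<in> {1..v} \<Longrightarrow> H j = proj_zeros (l j)"
      by metis
    have point: "\<exists>a. a \<noteq> 0 \<and> (\<Inter>i\<in>s. H i) = {range (\<lambda>c. c *s a)}" if s: "s \<in> subsets_of_card n v" for s
    proof -
      obtain P where P: "(\<Inter>i\<in>s. H i) = {P}"
        using assms(8) s unfolding meet_properly_def by blast
      \<comment> \<open>A nonempty \<open>s\<close> is what places \<open>P\<close> in some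
        hyperplane and hence in \<open>proj_space\<close>.\<close>
      have "s \<noteq> {}" "s \<subseteq> {1..v}"
        using s assms(2) by (auto simp: subsets_of_card_def)
      then obtain i where "P \<in> H i" "i \<in> {1..v}"
        using P by blast
      then have "P \<in> proj_space"
        by (simp add: l proj_zeros_def)
      then show ?thesis
        using P by (auto simp: proj_space_def)
    qed
    then obtain p where p: "\<And>s. s \<in> subsets_of_card n v \<Longrightarrow> p s \<noteq> 0"
      "\<And>s. s \<in> subsets_of_card n v \<Longrightarrow> (\<Inter>i\<in>s. H i) = {range (\<lambda>c. c *s p s)}"
      by metis
    have in_H: "range (\<lambda>c. c *s a) \<in> H i \<longleftrightarrow> mpol_eval (l i) a = 0" if "i \<in> {1..v}" "a \<noteq> 0" for a i
      using that form_vanishes_on_line_iff[OF l(1)[OF that(1)], of a]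
      by (auto simp: l proj_zeros_def proj_space_def)
    interpret star_configuration_complement n v l p B
    proof
      fix s i assume s: "s \<in> subsets_of_card n v" and i: "i \<in> {1..v}"
      \<comment> \<open>Otherwise \<open>n + 1\<close> of the hyperplanes would share a point,
        against the second half of \<open>meet_properly\<close>.\<close>
      have "i \<in> s" if "range (\<lambda>c. c *s p s) \<in> H i"
      proof (rule ccontr)
        assume "i \<notin> s"
        then have "insert i s \<in> subsets_of_card (n + 1) v"
          using s i by (auto simp: subsets_of_card_def finite_subset)
        then have "(\<Inter>j\<in>insert i s. H j) = {}"
          using assms(8) unfolding meet_properly_def by blast
        then show False
          using p(2)[OF s] that by auto
      qed
      moreover have "range (\<lambda>c. c *s p s) \<in> H i" if "i \<in> s"
        using p(2)[OF s] that by blast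
      ultimately show "mpol_eval (l i) (p s) = 0 \<longleftrightarrow> i \<in> s"
        using in_H[OF i p(1)[OF s]] by blast
    qed (use assms l p B unique False in auto)
    have "config_points H (subsets_of_card n v - B) = X"
      unfolding config_points_def X_def C_def
      by (rule image_cong) (auto simp: config_point_def p)
    then show ?thesis
      using h_vector_X assms(2) by simp
  qed
qed

end
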